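(* If there exists a conference graph on $v$ vertices, then there exists a complex $v\times 2v$ equiangular tight frame (ETF). Explicitly, let $A\in\mathbb{R}^{v\times v}$ denote the $\{0,1\}$-adjacency matrix of a conference graph on $v$ vertices, and let $B=J-I-A$ denote the adjacency matrix of the complementary graph. Pick $\varepsilon\in\{\pm1\}$ and define \[ x:=\frac{-1+\sqrt{2v-1}}{v-1},\qquad y:=\sqrt{1-x^2},\qquad \beta:=\varepsilon x+\mathrm{i}y. \] Then \[ \begin{bmatrix} A-B & \varepsilon I+\beta A+\overline{\beta}B\\ \varepsilon I+\overline{\beta}A+\beta B & B-A\end{bmatrix} \] is the signature matrix of a complex $v\times 2v$ ETF.
   Context: $I$ is the identity matrix, $J$ is the all-ones matrix, and $\mathrm{i}=\sqrt{-1}$. A conference graph on $v$ vertices is a strongly regular graph on $v$ vertices in which every vertex has $k=\frac{v-1}{2}$ neighbors, every pair of adjacent vertices has $\lambda=\frac{v-5}{4}$ common neighbors, and every pair of distinct nonadjacent vertices has $\mu=\frac{v-1}{4}$ common neighbors (as usual, a strongly regular graph is neither empty nor complete, so $v\geq 5$). A $d\times n$ equiangular tight frame (ETF) is a matrix $\Phi\in\mathbb{C}^{d\times n}$ with unit-norm columns such that all off-diagonal entries of the Gram matrix $\Phi^*\Phi$ have the same modulus and $\Phi\Phi^*$ is a multiple of the identity matrix. If $n>d$, then $\Phi^*\Phi=I+\gamma S$, where $\gamma>0$ is the common modulus of the off-diagonal entries of $\Phi^*\Phi$; the matrix $S$ (zero diagonal, unimodular off-diagonal entries) is called the signature matrix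 of $\Phi$. *)

theory Defs
  imports
    Complex_Main
    "HOL-Analysis.L2_Norm"
    "Graph_Theory.Pair_Digraph"
    "Jordan_Normal_Form.Schur_Decomposition"
begin

text \<open>
  A finite simple graph is a \<open>pair_graph\<close>: a finite loop-free digraph with symmetric arc set, in
  which each edge is represented by its two opposite arcs.
\<close>

definition neighbors :: "'a pair_pre_digraph \<Rightarrow> 'a \<Rightarrow> 'a set" where
  "neighbors G a = {b \<in> pverts G. (a, b) \<in> parcs G}"

text \<open>The last two conjuncts say that the graph is neither empty nor complete.\<close>

definition strongly_regular_graph :: "nat \<Rightarrow> nat \<Rightarrow> nat \<Rightarrow> nat \<Rightarrow> 'a pair_pre_digraph \<Rightarrow> bool" where
  "strongly_regular_graph v k l m G \<longleftrightarrow>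
     pair_graph G \<and> card (pverts G) = v \<and>
     (\<forall>a\<in>pverts G. card (neighbors G a) = k) \<and>
     (\<forall>a\<in>pverts G. \<forall>b\<in>pverts G. (a, b) \<in> parcs G \<longrightarrow>
        card (neighbors G a \<inter> neighbors G b) = l) \<and>
     (\<forall>a\<in>pverts G. \<forall>b\<in>pverts G. a \<noteq> b \<and> (a, b) \<notin> parcs G \<longrightarrow>
        card (neighbors G a \<inter> neighbors G b) = m) \<and>
     parcs G \<noteq> {} \<and>
     (\<exists>a\<in>pverts G. \<exists>b\<in>pverts G. a \<noteq> b \<and> (a, b) \<notin> parcs G)"

text \<open>
  The parameters are compared as real numbers, so that the divisions are exact and the
  subtractions are not truncated.
\<close>

definition conference_graph :: "nat \<Rightarrow> 'a pair_pre_digraph \<Rightarrow> bool" where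
  "conference_graph v G \<longleftrightarrow>
     (\<exists>k l m. strongly_regular_graph v k l m G \<and>
        real k = (real v - 1) / 2 \<and> real l = (real v - 5) / 4 \<and> real m = (real v - 1) / 4)"

text \<open>
  The adjacency matrix depends on an ordering of the vertices, given by the list \<open>vs\<close>, which is
  meant to contain every vertex exactly once.
\<close>

definition adjacency_matrix :: "'a pair_pre_digraph \<Rightarrow> 'a list \<Rightarrow> real mat" where
  "adjacency_matrix G vs =
     mat (length vs) (length vs) (\<lambda>(i, j). if (vs ! i, vs ! j) \<in> parcs G then 1 else 0)"

definition all_ones_mat :: "nat \<Rightarrow> real mat" where
  "all_ones_mat n = mat n n (\<lambda>_. 1)"

abbreviation complex_mat :: "real mat \<Rightarrow> complex mat" where
  "complex_mat \<equiv> map_mat complex_of_real"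

abbreviation gram_mat :: "complex mat \<Rightarrow> complex mat" where
  "gram_mat \<Phi> \<equiv> mat_adjoint \<Phi> * \<Phi>"

definition off_diagonal_modulus :: "nat \<Rightarrow> complex mat \<Rightarrow> real \<Rightarrow> bool" where
  "off_diagonal_modulus n M \<gamma> \<longleftrightarrow> (\<forall>i<n. \<forall>j<n. i \<noteq> j \<longrightarrow> cmod (M $$ (i, j)) = \<gamma>)"

definition equiangular_tight_frame :: "nat \<Rightarrow> nat \<Rightarrow> complex mat \<Rightarrow> bool" where
  "equiangular_tight_frame d n \<Phi> \<longleftrightarrow>
     \<Phi> \<in> carrier_mat d n \<and>
     (\<forall>j<n. L2_set (\<lambda>i. cmod (\<Phi> $$ (i, j))) {..<d} = 1) \<and>
     (\<exists>\<gamma>. off_diagonal_modulus n (gram_mat \<Phi>) \<gamma>) \<and>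
     (\<exists>c. \<Phi> * mat_adjoint \<Phi> = c \<cdot>\<^sub>m 1\<^sub>m d)"

text \<open>
  That \<open>S\<close> has zero diagonal and unimodular off-diagonal entries need not be required: it follows
  from the equation, since the columns of \<open>\<Phi>\<close> have unit norm and \<open>\<gamma>\<close> is the common modulus.
\<close>

definition signature_matrix :: "nat \<Rightarrow> nat \<Rightarrow> complex mat \<Rightarrow> complex mat \<Rightarrow> bool" where
  "signature_matrix d n \<Phi> S \<longleftrightarrow>
     d < n \<and> equiangular_tight_frame d n \<Phi> \<and> S \<in> carrier_mat n n \<and>
     (\<exists>\<gamma>>0. off_diagonal_modulus n (gram_mat \<Phi>) \<gamma> \<and>
        gram_mat \<Phi> = 1\<^sub>m n + complex_of_real \<gamma> \<cdot>\<^sub>m S)"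

end

theory Submission
  imports Defs
begin

text \<open>
  The matrix \<open>P = A - B\<close> satisfies \<open>P\<^sup>2 = v I - J\<close> and \<open>P J = 0\<close>, so \<open>I\<close>, \<open>J\<close>, \<open>P\<close> span a
  commutative algebra isomorphic to \<open>\<complex>\<^sup>3\<close>, which contains all four blocks of the signature matrix.
  With \<open>Q\<close> the upper right block, \<open>x\<close> is the root of a quadratic equation that makes
  \<open>P\<^sup>2 + Q Q\<^sup>* = (2 v - 1) I\<close>. Put \<open>\<gamma> = 1 / sqrt (2 v - 1)\<close>. Then \<open>I + \<gamma> P\<close> is positive
  definite; let \<open>X\<close> be its square root and \<open>Y = \<gamma> X\<^sup>-\<^sup>1 Q\<close>. The matrix \<open>[X Y]\<close> is the required frame,
  because \<open>Y\<^sup>* Y = (I + \<gamma> P)\<^sup>-\<^sup>1 (I - \<gamma>\<^sup>2 P\<^sup>2) = I - \<gamma> P\<close>; all these identities are checked on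
  eigenvalues.
\<close>

section \<open>Adjoints and Gram matrices of horizontally joined blocks\<close>

lemma mat_adjoint_carrier [simp]: "mat_adjoint A \<in> carrier_mat n m" if "A \<in> carrier_mat m n"
  using that by (auto simp: mat_adjoint_def)

lemma dim_mat_adjoint [simp]:
  "dim_row (mat_adjoint A) = dim_col A" "dim_col (mat_adjoint A) = dim_row A"
  by (auto simp: mat_adjoint_def)

lemma index_mat_adjoint [simp]:
  "i < dim_col A \<Longrightarrow> j < dim_row A \<Longrightarrow> mat_adjoint A $$ (i, j) = conjugate (A $$ (j, i))"
  by (simp add: mat_adjoint_def mat_of_rows_index)

text \<open>The block matrix \<open>[X Y]\<close>, given lower blocks without rows so that block
  multiplication applies.\<close>

definition join_cols :: "complex mat \<Rightarrow> complex mat \<Rightarrow> complex mat" where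
  "join_cols X Y = four_block_mat X Y (0\<^sub>m 0 (dim_col X)) (0\<^sub>m 0 (dim_col Y))"

lemma join_cols_carrier:
  assumes "X \<in> carrier_mat d m" "Y \<in> carrier_mat d n"
  shows "join_cols X Y \<in> carrier_mat d (m + n)"
  using assms by (auto simp: join_cols_def)

lemma mat_adjoint_join_cols:
  assumes "X \<in> carrier_mat d m" "Y \<in> carrier_mat d n"
  shows "mat_adjoint (join_cols X Y) =
    four_block_mat (mat_adjoint X) (0\<^sub>m m 0) (mat_adjoint Y) (0\<^sub>m n 0)"
  using assms by (intro eq_matI) (auto simp: join_cols_def)

lemma gram_mat_join_cols:
  assumes X: "X \<in> carrier_mat d m" and Y: "Y \<in> carrier_mat d n"
  shows "gram_mat (join_cols X Y) = four_block_mat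
    (mat_adjoint X * X) (mat_adjoint X * Y) (mat_adjoint Y * X) (mat_adjoint Y * Y)"
proof -
  have c: "dim_col X = m" "dim_col Y = n" using X Y by auto
  \<comment> \<open>The empty blocks contribute sums over an empty index set to the product.\<close>
  have [simp]: "(0\<^sub>m k 0 :: complex mat) * 0\<^sub>m 0 l = 0\<^sub>m k l" for k l
    by (intro eq_matI) (auto simp: scalar_prod_def)
  have XY: "mat_adjoint X \<in> carrier_mat m d" "mat_adjoint Y \<in> carrier_mat n d"
    using X Y by auto
  show ?thesis
    unfolding mat_adjoint_join_cols[OF X Y] unfolding join_cols_def c
    by (subst mult_four_block_mat[where ?nr1.0 = m and ?n1.0 = d and ?n2.0 = 0 and ?nr2.0 = n
          and ?nc1.0 = m and ?nc2.0 = n])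
      (use X Y XY in \<open>auto intro!: cong_four_block_mat right_add_zero_mat\<close>)
qed

lemma join_cols_mult_mat_adjoint:
  assumes X: "X \<in> carrier_mat d m" and Y: "Y \<in> carrier_mat d n"
  shows "join_cols X Y * mat_adjoint (join_cols X Y) = X * mat_adjoint X + Y * mat_adjoint Y"
proof -
  have c: "dim_col X = m" "dim_col Y = n" using X Y by auto
  have XY: "mat_adjoint X \<in> carrier_mat m d" "mat_adjoint Y \<in> carrier_mat n d"
    using X Y by auto
  show ?thesis
    unfolding mat_adjoint_join_cols[OF X Y] unfolding join_cols_def c
    by (subst mult_four_block_mat[where ?nr1.0 = d and ?n1.0 = m and ?n2.0 = n and ?nr2.0 = 0
          and ?nc1.0 = d and ?nc2.0 = 0])
      (use X Y XY in \<open>auto intro!: eq_matI\<close>)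
qed

text \<open>The Gram equation yields the unit norms on its diagonal and the equal moduli off it;
  tightness is a separate hypothesis.\<close>

lemma signature_matrixI:
  assumes \<Phi>: "\<Phi> \<in> carrier_mat d n" and S: "S \<in> carrier_mat n n"
    and "d < n" and "\<gamma> > 0"
    and diag: "\<And>i. i < n \<Longrightarrow> S $$ (i, i) = 0"
    and off: "\<And>i j. i < n \<Longrightarrow> j < n \<Longrightarrow> i \<noteq> j \<Longrightarrow> cmod (S $$ (i, j)) = 1"
    and gram: "gram_mat \<Phi> = 1\<^sub>m n + complex_of_real \<gamma> \<cdot>\<^sub>m S"
    and tight: "\<Phi> * mat_adjoint \<Phi> = c \<cdot>\<^sub>m 1\<^sub>m d"
  shows "signature_matrix d n \<Phi> S"
proof -
  have mod: "off_diagonal_modulus n (gram_mat \<Phi>) \<gamma>"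
    using S off \<open>\<gamma> > 0\<close> by (auto simp: off_diagonal_modulus_def gram norm_mult)
  have "L2_set (\<lambda>i. cmod (\<Phi> $$ (i, j))) {..<d} = 1" if j: "j < n" for j
  proof -
    have "complex_of_real (\<Sum>i<d. (cmod (\<Phi> $$ (i, j)))\<^sup>2) = gram_mat \<Phi> $$ (j, j)"
      using \<Phi> j by (auto simp: scalar_prod_def conjugate_complex_def complex_norm_square
          atLeast0LessThan mult.commute intro!: sum.cong simp del: of_real_power)
    also have "\<dots> = 1" using S j by (simp add: gram diag)
    finally have "(\<Sum>i<d. (cmod (\<Phi> $$ (i, j)))\<^sup>2) = 1"
      using of_real_eq_1_iff by blast
    then show ?thesis by (simp add: L2_set_def)
  qed
  with mod show ?thesis
    using assms by (auto simp: signature_matrix_def equiangular_tight_frame_def)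
qed

section \<open>The commutative algebra spanned by \<open>I\<close>, \<open>J\<close> and
  \<open>P\<close>\<close>

locale conference_matrix =
  fixes n :: nat and P :: "nat \<Rightarrow> nat \<Rightarrow> real"
  assumes n_pos: "n > 0"
    and symm: "i < n \<Longrightarrow> j < n \<Longrightarrow> P i j = P j i"
    and row_sum: "i < n \<Longrightarrow> (\<Sum>k<n. P i k) = 0"
    and square: "i < n \<Longrightarrow> j < n \<Longrightarrow> (\<Sum>k<n. P i k * P k j) = (if i = j then real n else 0) - 1"
begin

text \<open>This is \<open>a I + b J + c P\<close>.\<close>

definition comb :: "complex \<Rightarrow> complex \<Rightarrow> complex \<Rightarrow> complex mat" where
  "comb a b c = mat n n (\<lambda>(i, j). (if i = j then a else 0) + b + c * P i j)"

text \<open>Bilinear expansion with \<open>J^2 = n J\<close>, \<open>P J = J P = 0\<close> and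
  \<open>P^2 = n I - J\<close>.\<close>

lemma comb_mult:
  fixes a b c a' b' c' :: complex
  shows "comb a b c * comb a' b' c' =
    comb (a * a' + n * c * c') (a * b' + b * a' + n * b * b' - c * c') (a * c' + c * a')"
proof (intro eq_matI)
  fix i j assume "i < dim_row (comb (a * a' + n * c * c')
      (a * b' + b * a' + n * b * b' - c * c') (a * c' + c * a'))"
    and "j < dim_col (comb (a * a' + n * c * c')
      (a * b' + b * a' + n * b * b' - c * c') (a * c' + c * a'))"
  then have ij: "i < n" "j < n" by (auto simp: comb_def)
  have col: "(\<Sum>k<n. P k j) = 0"
    using row_sum[OF ij(2)] symm ij(2) by (metis (no_types, lifting) lessThan_iff sum.cong)
  have "(comb a b c * comb a' b' c') $$ (i, j) =
     (\<Sum>k<n. ((if i = k then a else 0) + b + c * P i k) * ((if k = j then a' else 0) + b' + c' * P k j))"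
    using ij by (simp add: comb_def scalar_prod_def atLeast0LessThan)
  \<comment> \<open>The product of the two Kronecker deltas is counted once, in the term for
    \<open>k = i\<close>.\<close>
  also have "\<dots> = (\<Sum>k<n. (if k = i then a * ((if i = j then a' else 0) + b' + c' * P i j) else 0)
      + (if k = j then b * a' + c * a' * P i j else 0)
      + b * b' + b * c' * P k j + c * b' * P i k + c * c' * of_real (P i k * P k j))"
    by (intro sum.cong) (auto simp: algebra_simps)
  also have "\<dots> = a * ((if i = j then a' else 0) + b' + c' * P i j) + (b * a' + c * a' * P i j)
      + n * b * b' + b * c' * of_real (\<Sum>k<n. P k j) + c * b' * of_real (\<Sum>k<n. P i k)
      + c * c' * of_real (\<Sum>k<n. P i k * P k j)"
    using ij by (simp add: sum.distrib sum_distrib_left mult.assoc)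
  also have "\<dots> = comb (a * a' + n * c * c')
      (a * b' + b * a' + n * b * b' - c * c') (a * c' + c * a') $$ (i, j)"
    unfolding col row_sum[OF ij(1)] square[OF ij] using ij
    by (auto simp: comb_def algebra_simps)
  finally show "(comb a b c * comb a' b' c') $$ (i, j) = \<dots>" .
qed (auto simp: comb_def)

text \<open>
  The matrix with eigenvalues \<open>p\<close>, \<open>q\<close>, \<open>r\<close> on the eigenspaces of \<open>P\<close> for \<open>0\<close>, \<open>sqrt n\<close>,
  \<open>- sqrt n\<close>; the spectral idempotents are \<open>J / n\<close> and \<open>(I - J / n \<plusminus> P / sqrt n) / 2\<close>.
\<close>

definition spec :: "complex \<Rightarrow> complex \<Rightarrow> complex \<Rightarrow> complex mat" where
  "spec p q r = comb ((q + r) / 2) ((p - (q + r) / 2) / n) ((q - r) / (2 * sqrt n))"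

lemma spec_carrier [simp]: "spec p q r \<in> carrier_mat n n"
  and dim_spec [simp]: "dim_row (spec p q r) = n" "dim_col (spec p q r) = n"
  by (auto simp: spec_def comb_def)

lemma index_spec:
  "i < n \<Longrightarrow> j < n \<Longrightarrow> spec p q r $$ (i, j) =
    (if i = j then (q + r) / 2 else 0) + (p - (q + r) / 2) / n + (q - r) / (2 * sqrt n) * P i j"
  by (simp add: spec_def comb_def)

text \<open>The spectral idempotents are mutually orthogonal, so eigenvalues multiply
  separately.\<close>

lemma spec_mult: "spec p q r * spec p' q' r' = spec (p * p') (q * q') (r * r')"
proof -
  \<comment> \<open>Writing \<open>n\<close> as \<open>s * s\<close> turns the coefficients of
    \<open>I\<close>, \<open>J\<close> and \<open>P\<close> in \<open>comb_mult\<close> into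
    rational functions of \<open>s\<close>; they are compared one by one.\<close>
  define s where "s = complex_of_real (sqrt n)"
  have s: "s \<noteq> 0" "complex_of_nat n = s * s" "complex_of_real (2 * sqrt n) = 2 * s"
    using n_pos by (auto simp: s_def simp flip: of_real_mult[of "sqrt n" "sqrt n"])
  have "(q + r) / 2 * ((q' + r') / 2) + s * s * ((q - r) / (2 * s)) * ((q' - r') / (2 * s))
      = (q * q' + r * r') / 2"
    using s(1) by (simp add: field_simps)
  moreover have "(q + r) / 2 * ((p' - (q' + r') / 2) / (s * s))
      + (p - (q + r) / 2) / (s * s) * ((q' + r') / 2)
      + s * s * ((p - (q + r) / 2) / (s * s)) * ((p' - (q' + r') / 2) / (s * s))
      - (q - r) / (2 * s) * ((q' - r') / (2 * s)) = (p * p' - (q * q' + r * r') / 2) / (s * s)"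
    using s(1) by (simp add: field_simps)
  moreover have "(q + r) / 2 * ((q' - r') / (2 * s)) + (q - r) / (2 * s) * ((q' + r') / 2)
      = (q * q' - r * r') / (2 * s)"
    using s(1) by (simp add: field_simps)
  ultimately show ?thesis
    unfolding spec_def comb_mult s(2,3) by (simp only:)
qed

lemma spec_add: "spec p q r + spec p' q' r' = spec (p + p') (q + q') (r + r')"
  by (intro eq_matI) (auto simp: index_spec add_divide_distrib diff_divide_distrib algebra_simps)

lemma spec_smult: "c \<cdot>\<^sub>m spec p q r = spec (c * p) (c * q) (c * r)"
  by (intro eq_matI) (auto simp: index_spec add_divide_distrib diff_divide_distrib algebra_simps)

lemma spec_one: "1\<^sub>m n = spec 1 1 1"
  by (intro eq_matI) (auto simp: index_spec)

text \<open>The idempotents are real symmetric, so only the eigenvalues get conjugated.\<close>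

lemma mat_adjoint_spec: "mat_adjoint (spec p q r) = spec (cnj p) (cnj q) (cnj r)"
  by (intro eq_matI) (auto simp: index_spec conjugate_complex_def symm)

text \<open>With \<open>Q\<close> the upper right block, the hypotheses on \<open>q\<^sub>0\<close>
  and \<open>q\<close> express \<open>P^2 + Q Q^* = (2 n - 1) I\<close> on the eigenspaces of
  \<open>P\<close>: the left side is \<open>q\<^sub>0^2\<close> on the first and
  \<open>n + |q|^2\<close> on the other two.\<close>

lemma signature_matrix_four_block_spec:
  fixes q\<^sub>0 :: real and q :: complex
  assumes q\<^sub>0: "q\<^sub>0\<^sup>2 = 2 * real n - 1" and q: "(cmod q)\<^sup>2 = real n - 1"
    and "n > 1"
  defines "S \<equiv> four_block_mat (spec 0 (sqrt n) (- sqrt n)) (spec q\<^sub>0 q (cnj q))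
      (spec q\<^sub>0 (cnj q) q) (spec 0 (- sqrt n) (sqrt n))"
  assumes diag: "\<And>i. i < 2 * n \<Longrightarrow> S $$ (i, i) = 0"
    and off: "\<And>i j. i < 2 * n \<Longrightarrow> j < 2 * n \<Longrightarrow> i \<noteq> j \<Longrightarrow> cmod (S $$ (i, j)) = 1"
  shows "\<exists>\<Phi>. signature_matrix n (2 * n) \<Phi> S"
proof -
  \<comment> \<open>With this scaling \<open>\<gamma> S\<close> squares to the identity, so
    \<open>I + \<gamma> S\<close> has no eigenvalues besides 0 and 2.\<close>
  define \<gamma> where "\<gamma> = 1 / sqrt (2 * real n - 1)"
  \<comment> \<open>The eigenvalues of the square root of \<open>I + \<gamma> P\<close> are 1,
    \<open>u\<close> and \<open>w\<close>.\<close>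
  define u where "u = sqrt (1 + \<gamma> * sqrt n)"
  define w where "w = sqrt (1 - \<gamma> * sqrt n)"
  have \<gamma>: "\<gamma> > 0" "\<gamma>\<^sup>2 * (2 * real n - 1) = 1"
    using \<open>n > 1\<close> by (auto simp: \<gamma>_def power_divide)
  \<comment> \<open>This is \<open>n < 2 n - 1\<close>; it makes \<open>w\<close> positive and hence
    \<open>X\<close> invertible.\<close>
  have "\<gamma> * sqrt n < 1"
    using \<open>n > 1\<close> by (simp add: \<gamma>_def)
  then have uw: "u > 0" "w > 0" "u\<^sup>2 = 1 + \<gamma> * sqrt n" "w\<^sup>2 = 1 - \<gamma> * sqrt n"
    using \<gamma>(1) by (auto simp: u_def w_def add_pos_nonneg)
  \<comment> \<open>The resulting identity says that \<open>\<gamma> q / u\<close> has modulus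
    \<open>w\<close> and \<open>\<gamma> q / w\<close> has modulus \<open>u\<close>, which gives the
    eigenvalues of \<open>Y Y^*\<close>.\<close>
  have "u\<^sup>2 * w\<^sup>2 = 1 - \<gamma>\<^sup>2 * n"
    unfolding uw(3,4) by (simp add: algebra_simps power2_eq_square)
  also have "\<dots> = \<gamma>\<^sup>2 * (cmod q)\<^sup>2"
    using \<gamma>(2) by (simp add: q algebra_simps)
  finally have norm_q: "\<gamma>\<^sup>2 * (cmod q)\<^sup>2 = u\<^sup>2 * w\<^sup>2" ..
  have cnj_q: "complex_of_real \<gamma> * \<gamma> * (q * cnj q) = of_real (u\<^sup>2 * w\<^sup>2)"
    unfolding complex_norm_square[symmetric] norm_q[symmetric] by (simp add: power2_eq_square)
  have uu: "complex_of_real u * u = 1 + \<gamma> * sqrt n" and ww: "complex_of_real w * w = 1 - \<gamma> * sqrt n"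
    using uw(3,4) by (simp_all add: power2_eq_square flip: of_real_mult of_real_add of_real_diff)
  have q0q0: "complex_of_real \<gamma> * q\<^sub>0 * (\<gamma> * q\<^sub>0) = 1"
    using \<gamma>(2) unfolding q\<^sub>0[symmetric]
    by (simp add: power2_eq_square algebra_simps flip: of_real_mult)
  have qu: "(complex_of_real \<gamma> * q / u) * cnj (complex_of_real \<gamma> * q / u) = 1 - \<gamma> * sqrt n"
    unfolding ww[symmetric] using cnj_q uw(1,2) by (simp add: field_simps power2_eq_square)
  have qw: "(complex_of_real \<gamma> * cnj q / w) * cnj (complex_of_real \<gamma> * cnj q / w) = 1 + \<gamma> * sqrt n"
    unfolding uu[symmetric] using cnj_q uw(1,2) by (simp add: field_simps power2_eq_square)
  define X where "X = spec 1 u w"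
  define Y where "Y = spec (\<gamma> * q\<^sub>0) (\<gamma> * q / u) (\<gamma> * cnj q / w)"
  have XY: "X \<in> carrier_mat n n" "Y \<in> carrier_mat n n" by (auto simp: X_def Y_def)
  have XX: "mat_adjoint X * X = spec 1 (1 + \<gamma> * sqrt n) (1 - \<gamma> * sqrt n)"
    by (simp add: X_def mat_adjoint_spec spec_mult uu ww)
  have XX': "X * mat_adjoint X = spec 1 (1 + \<gamma> * sqrt n) (1 - \<gamma> * sqrt n)"
    by (simp add: X_def mat_adjoint_spec spec_mult uu ww)
  have YY': "Y * mat_adjoint Y = spec 1 (1 - \<gamma> * sqrt n) (1 + \<gamma> * sqrt n)"
    unfolding Y_def mat_adjoint_spec spec_mult qu qw using q0q0 by simp
  have YY: "mat_adjoint Y * Y = spec 1 (1 - \<gamma> * sqrt n) (1 + \<gamma> * sqrt n)"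
    using YY' unfolding Y_def mat_adjoint_spec spec_mult by (simp only: mult.commute)
  have XY': "mat_adjoint X * Y = spec (\<gamma> * q\<^sub>0) (\<gamma> * q) (\<gamma> * cnj q)"
    using uw by (simp add: X_def Y_def mat_adjoint_spec spec_mult)
  have YX: "mat_adjoint Y * X = spec (\<gamma> * q\<^sub>0) (\<gamma> * cnj q) (\<gamma> * q)"
    using uw by (simp add: X_def Y_def mat_adjoint_spec spec_mult)
  have "gram_mat (join_cols X Y) = 1\<^sub>m (2 * n) + complex_of_real \<gamma> \<cdot>\<^sub>m S"
    unfolding gram_mat_join_cols[OF XY] XX XY' YX YY S_def mult_2 four_block_one_mat[symmetric]
    by (subst smult_four_block_mat[where ?nr1.0 = n and ?nr2.0 = n and ?nc1.0 = n and ?nc2.0 = n],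
        simp_all del: four_block_one_mat)
      (subst add_four_block_mat[where ?nr1.0 = n and ?nr2.0 = n and ?nc1.0 = n and ?nc2.0 = n],
        simp_all add: spec_one spec_add spec_smult del: four_block_one_mat)
  \<comment> \<open>The sum is \<open>(I + \<gamma> P) + (I - \<gamma> P)\<close>.\<close>
  moreover have "join_cols X Y * mat_adjoint (join_cols X Y) = 2 \<cdot>\<^sub>m 1\<^sub>m n"
    unfolding join_cols_mult_mat_adjoint[OF XY] XX' YY' spec_one spec_add spec_smult by simp
  moreover have "join_cols X Y \<in> carrier_mat n (2 * n)"
    using join_cols_carrier[OF XY] by (simp add: mult_2)
  moreover have "S \<in> carrier_mat (2 * n) (2 * n)"
    unfolding S_def mult_2 by (intro four_block_carrier_mat) auto
  ultimately have "signature_matrix n (2 * n) (join_cols X Y) S"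
    using \<open>n > 1\<close> \<gamma>(1) by (intro signature_matrixI[OF _ _ _ _ diag off]) simp_all
  then show ?thesis ..
qed

end

section \<open>The Seidel matrix of a conference graph\<close>

text \<open>The negative of the usual Seidel matrix: adjacency gets +1, to agree with
  \<open>A - B\<close>.\<close>

definition seidel :: "'a pair_pre_digraph \<Rightarrow> 'a \<Rightarrow> 'a \<Rightarrow> real" where
  "seidel G a b = (if a = b then 0 else if (a, b) \<in> parcs G then 1 else -1)"

text \<open>The number of common neighbors of adjacent vertices is a natural number, so
  \<open>(v - 5) / 4\<close> is nonnegative.\<close>

lemma conference_graph_card_ge: "v \<ge> 5" if "conference_graph v G"
proof -
  from that obtain l where "real l = (real v - 5) / 4"
    unfolding conference_graph_def by blast
  then have "real v = 5 + 4 * real l" by simp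
  then show ?thesis by linarith
qed

text \<open>The matrix is \<open>2 A - J + I\<close>; its square is expanded and \<open>A^2\<close>
  eliminated by the strongly regular graph equation.\<close>

lemma conference_matrix_seidel:
  assumes G: "conference_graph v G" and vs: "distinct vs" "set vs = pverts G"
  shows "conference_matrix v (\<lambda>i j. seidel G (vs ! i) (vs ! j))"
proof -
  obtain k l m where srg: "strongly_regular_graph v k l m G"
    and k: "real k = (real v - 1) / 2" and l: "real l = (real v - 5) / 4"
    and m: "real m = (real v - 1) / 4"
    using G unfolding conference_graph_def by blast
  have "pair_graph G" and card: "card (pverts G) = v"
    using srg by (auto simp: strongly_regular_graph_def)
  then interpret pair_graph G by simp
  have fin: "finite (pverts G)" by (rule pair_finite_verts)
  have arc_sym: "(a, b) \<in> parcs G \<longleftrightarrow> (b, a) \<in> parcs G" for a b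
    using pair_sym_arcs by (auto simp: symmetric_def sym_def)
  have no_loop: "(a, a) \<notin> parcs G" for a
    using pair_no_loops by fastforce
  have len: "length vs = v"
    using vs card distinct_card by fastforce
  have nth: "vs ! i \<in> pverts G" if "i < v" for i
    using that len vs(2) nth_mem by metis
  have sum_nth: "(\<Sum>i<v. f (vs ! i)) = (\<Sum>a\<in>pverts G. f a)" for f :: "'a \<Rightarrow> real"
    using sum.reindex_bij_betw[OF bij_betw_nth[OF vs(1) _ vs(2)[symmetric]], of "{..<v}" f] len
    by simp
  define N :: "'a \<Rightarrow> 'a \<Rightarrow> real" where "N a b = (if (a, b) \<in> parcs G then 1 else 0)" for a b
  have seidel: "seidel G a b = 2 * N a b - 1 + (if a = b then 1 else 0)" for a b
    using no_loop by (auto simp: seidel_def N_def)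
  have seidel_sym: "seidel G a b = seidel G b a" for a b
    using arc_sym by (auto simp: seidel_def)
  have sum_N: "(\<Sum>b\<in>pverts G. N a b) = k" if "a \<in> pverts G" for a
  proof -
    have "(\<Sum>b\<in>pverts G. N a b) = card (neighbors G a)"
      using fin by (simp add: N_def neighbors_def sum.If_cases Int_def)
    then show ?thesis using srg that by (simp add: strongly_regular_graph_def)
  qed
  \<comment> \<open>The conference parameters merge the cases of equal, adjacent and nonadjacent
    vertices into \<open>4 (A^2 + A) = (v - 1) (I + J)\<close>.\<close>
  have sum_NN: "4 * (\<Sum>c\<in>pverts G. N a c * N b c) + 4 * N a b
      = real v - 1 + (if a = b then real v - 1 else 0)"
    if ab: "a \<in> pverts G" "b \<in> pverts G" for a b
  proof -
    have "(\<Sum>c\<in>pverts G. N a c * N b c) =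
        (\<Sum>c\<in>pverts G. if (a, c) \<in> parcs G \<and> (b, c) \<in> parcs G then 1 else 0)"
      by (intro sum.cong) (auto simp: N_def)
    also have "\<dots> = card (neighbors G a \<inter> neighbors G b)"
      using fin by (auto simp: neighbors_def sum.If_cases intro!: arg_cong[where f = card])
    also have "\<dots> = (if a = b then k else if (a, b) \<in> parcs G then l else m)"
      using srg ab by (auto simp: strongly_regular_graph_def)
    finally have eq: "(\<Sum>c\<in>pverts G. N a c * N b c) = \<dots>" .
    show ?thesis
      unfolding eq using k l m no_loop by (auto simp: N_def field_simps)
  qed
  have row: "(\<Sum>b\<in>pverts G. seidel G a b) = 0" if "a \<in> pverts G" for a
    using that fin k by (simp add: seidel sum.distrib sum_subtractf sum_N card
        flip: sum_distrib_left)
  have square: "(\<Sum>c\<in>pverts G. seidel G a c * seidel G c b) = (if a = b then real v else 0) - 1"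
    if ab: "a \<in> pverts G" "b \<in> pverts G" for a b
  proof -
    \<comment> \<open>As in \<open>comb_mult\<close>, the two deltas are split off, and their
      product goes to the term for \<open>c = a\<close>.\<close>
    have "(\<Sum>c\<in>pverts G. seidel G a c * seidel G c b) =
      (\<Sum>c\<in>pverts G. 4 * (N a c * N b c) - 2 * N a c - 2 * N b c + 1
        + (if c = a then 2 * N b a - 1 + (if a = b then 1 else 0) else 0)
        + (if c = b then 2 * N a b - 1 else 0))"
      unfolding seidel_sym[of _ b]
      by (intro sum.cong) (auto simp: seidel algebra_simps)
    also have "\<dots> = 4 * (\<Sum>c\<in>pverts G. N a c * N b c) - 2 * k - 2 * k + v
        + (2 * N b a - 1 + (if a = b then 1 else 0)) + (2 * N a b - 1)"
      using fin ab by (simp add: sum.distrib sum_subtractf sum_N card flip: sum_distrib_left)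
    also have "N b a = N a b" using arc_sym by (simp add: N_def)
    finally show ?thesis
      using sum_NN[OF ab] k by (auto split: if_splits)
  qed
  show ?thesis
  proof
    show "v > 0" using conference_graph_card_ge[OF G] by simp
  next
    fix i j assume "i < v" "j < v"
    show "seidel G (vs ! i) (vs ! j) = seidel G (vs ! j) (vs ! i)" by (rule seidel_sym)
    show "(\<Sum>k<v. seidel G (vs ! i) (vs ! k)) = 0"
      using row[OF nth[OF \<open>i < v\<close>]] by (simp add: sum_nth)
    have "vs ! i = vs ! j \<longleftrightarrow> i = j"
      using \<open>i < v\<close> \<open>j < v\<close> len vs(1) by (simp add: nth_eq_iff_index_eq)
    then show "(\<Sum>k<v. seidel G (vs ! i) (vs ! k) * seidel G (vs ! k) (vs ! j)) =
        (if i = j then real v else 0) - 1"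
      using square[OF nth[OF \<open>i < v\<close>] nth[OF \<open>j < v\<close>]]
        sum_nth[of "\<lambda>c. seidel G (vs ! i) c * seidel G c (vs ! j)"] by simp
  qed
qed

section \<open>The explicit signature matrix\<close>

text \<open>Since \<open>A + B = J - I\<close> and \<open>P = A - B\<close>, the upper right block
  is \<open>\<epsilon> (1 - x) I + \<epsilon> x J + \<i> y P\<close>, and the lower left block is
  its adjoint. All blocks thus have the form \<open>spec\<close>.\<close>

lemma conference_graph_signature_matrix:
  fixes \<epsilon> x y :: real and \<beta> :: complex
  assumes G: "conference_graph v G" and vs: "distinct vs" "set vs = pverts G"
    and A: "A = adjacency_matrix G vs" and B: "B = all_ones_mat v - 1\<^sub>m v - A"
    and \<epsilon>: "\<epsilon> \<in> {1, -1}"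
    and x: "x = (-1 + sqrt (2 * real v - 1)) / (real v - 1)"
    and y: "y = sqrt (1 - x\<^sup>2)"
    and \<beta>: "\<beta> = complex_of_real (\<epsilon> * x) + \<i> * complex_of_real y"
  shows "\<exists>\<Phi>. signature_matrix v (2 * v) \<Phi>
    (four_block_mat
      (complex_mat (A - B))
      (complex_of_real \<epsilon> \<cdot>\<^sub>m 1\<^sub>m v + \<beta> \<cdot>\<^sub>m complex_mat A + cnj \<beta> \<cdot>\<^sub>m complex_mat B)
      (complex_of_real \<epsilon> \<cdot>\<^sub>m 1\<^sub>m v + cnj \<beta> \<cdot>\<^sub>m complex_mat A + \<beta> \<cdot>\<^sub>m complex_mat B)
      (complex_mat (B - A)))" (is "\<exists>\<Phi>. signature_matrix _ _ \<Phi> (four_block_mat _ ?Q ?R _)")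
proof -
  define P where "P i j = seidel G (vs ! i) (vs ! j)" for i j
  interpret conference_matrix v P
    unfolding P_def by (rule conference_matrix_seidel[OF G vs])
  have v: "v \<ge> 5" by (rule conference_graph_card_ge[OF G])
  have "pair_graph G" and "card (pverts G) = v"
    using G by (auto simp: conference_graph_def strongly_regular_graph_def)
  then interpret pair_graph G by simp
  have len: "length vs = v"
    using vs \<open>card (pverts G) = v\<close> distinct_card by fastforce
  have no_loop: "(a, a) \<notin> parcs G" for a
    using pair_no_loops by fastforce
  have P_diag: "P i i = 0" for i by (simp add: P_def seidel_def)
  have P_off: "P i j = 1 \<or> P i j = -1" if "i < v" "j < v" "i \<noteq> j" for i j
    using that vs(1) len by (auto simp: P_def seidel_def nth_eq_iff_index_eq)
  let ?S = "four_block_mat (complex_mat (A - B)) ?Q ?R (complex_mat (B - A))"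
  have dim: "A \<in> carrier_mat v v" "B \<in> carrier_mat v v"
    using len by (auto simp: A B adjacency_matrix_def all_ones_mat_def)
  have AB: "A $$ (i, j) = (1 + P i j - (if i = j then 1 else 0)) / 2"
    "B $$ (i, j) = (1 - P i j - (if i = j then 1 else 0)) / 2" if "i < v" "j < v" for i j
    using that len vs(1) no_loop
    by (auto simp: A B adjacency_matrix_def all_ones_mat_def P_def seidel_def nth_eq_iff_index_eq)
  have x_root: "x * (real v - 1) = sqrt (2 * real v - 1) - 1"
    using v by (simp add: x)
  \<comment> \<open>Squared, this is \<open>(v - 1)^2 \<ge> 0\<close>. It yields
    \<open>x \<le> 1\<close>, so the root defining \<open>y\<close> is that of a nonnegative
    number.\<close>
  have "sqrt (2 * real v - 1) \<le> real v"
    using v zero_le_power2[of "real v - 1"]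
    by (intro real_le_lsqrt) (auto simp: power2_eq_square algebra_simps)
  moreover have "sqrt (2 * real v - 1) \<ge> 1" using v by simp
  ultimately have "0 \<le> x" "x \<le> 1" using v by (auto simp: x)
  then have y2: "y\<^sup>2 = 1 - x\<^sup>2" by (simp add: y power_le_one)
  have \<epsilon>2: "\<epsilon>\<^sup>2 = 1" using \<epsilon> by auto
  have cmod_\<epsilon>: "cmod (complex_of_real \<epsilon>) = 1" using \<epsilon> by auto
  have cmod_\<beta>: "cmod \<beta> = 1"
    using \<epsilon>2 y2 by (simp add: \<beta> cmod_def power_mult_distrib)
  have "(x * (real v - 1) + 1)\<^sup>2 = 2 * real v - 1"
    using v by (simp add: x_root)
  then have "(real v - 1) * (x\<^sup>2 * (real v - 1) + 2 * x - 2) = 0"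
    by (simp add: power2_eq_square algebra_simps)
  \<comment> \<open>This quadratic equation is equivalent to \<open>|q|^2 = v - 1\<close> for the
    \<open>q\<close> below.\<close>
  then have quad: "x\<^sup>2 * (real v - 1) + 2 * x = 2" using v by simp
  \<comment> \<open>The eigenvalues of the upper right block are \<open>q\<^sub>0\<close>,
    \<open>q\<close> and \<open>cnj q\<close> on the eigenspaces of \<open>P\<close> for 0,
    \<open>sqrt v\<close> and \<open>- sqrt v\<close>.\<close>
  define q\<^sub>0 where "q\<^sub>0 = \<epsilon> * (x * (real v - 1) + 1)"
  define q where "q = Complex (\<epsilon> * (1 - x)) (y * sqrt v)"
  have q0: "q\<^sub>0\<^sup>2 = 2 * real v - 1"
    using v \<epsilon>2 by (simp add: q\<^sub>0_def x_root power_mult_distrib)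
  have "(cmod q)\<^sup>2 = (1 - x)\<^sup>2 + (1 - x\<^sup>2) * v"
    using \<epsilon>2 y2 by (simp add: q_def cmod_power2 power_mult_distrib)
  also have "\<dots> = real v - 1"
    using quad by (simp add: power2_eq_square algebra_simps)
  finally have q1: "(cmod q)\<^sup>2 = real v - 1" .
  \<comment> \<open>These quotients are the coefficients of \<open>I\<close>, \<open>P\<close> and,
    next, \<open>J\<close> in \<open>index_spec\<close>.\<close>
  have q_add: "(q + cnj q) / 2 = \<epsilon> * (1 - x)" and q_diff: "(q - cnj q) / (2 * sqrt v) = \<i> * y"
    using v by (auto simp: q_def complex_eq_iff)
  have q0_diff: "(q\<^sub>0 - complex_of_real (\<epsilon> * (1 - x))) / v = complex_of_real (\<epsilon> * x)"
    using v by (simp add: q\<^sub>0_def field_simps)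
  have q_diff': "(cnj q - q) / (2 * sqrt v) = - \<i> * y"
    using v by (auto simp: q_def complex_eq_iff)
  have index_Q: "spec q\<^sub>0 q (cnj q) $$ (i, j) =
      (if i = j then of_real (\<epsilon> * (1 - x)) else 0) + of_real (\<epsilon> * x) + \<i> * y * P i j"
    and index_R: "spec q\<^sub>0 (cnj q) q $$ (i, j) =
      (if i = j then of_real (\<epsilon> * (1 - x)) else 0) + of_real (\<epsilon> * x) - \<i> * y * P i j"
    if "i < v" "j < v" for i j
    unfolding index_spec[OF that] add.commute[of "cnj q"] q_add q0_diff q_diff q_diff' by simp_all
  have blocks_diag: "complex_mat (A - B) = spec 0 (sqrt v) (- sqrt v)"
    "complex_mat (B - A) = spec 0 (- sqrt v) (sqrt v)"
    by (intro eq_matI; use v dim in \<open>simp add: index_spec AB field_simps\<close>)+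
  have blocks_off: "?Q = spec q\<^sub>0 q (cnj q)" "?R = spec q\<^sub>0 (cnj q) q"
    by (intro eq_matI; use dim in \<open>simp add: index_Q index_R AB \<beta> field_simps\<close>)+
  have S: "?S = four_block_mat (spec 0 (sqrt v) (- sqrt v)) (spec q\<^sub>0 q (cnj q))
      (spec q\<^sub>0 (cnj q) q) (spec 0 (- sqrt v) (sqrt v))"
    unfolding blocks_diag blocks_off ..
  have entries: "complex_mat (A - B) $$ (i, j) = P i j" "complex_mat (B - A) $$ (i, j) = - P i j"
    "?Q $$ (i, j) = (if i = j then \<epsilon> else if P i j = 1 then \<beta> else cnj \<beta>)"
    "?R $$ (i, j) = (if i = j then \<epsilon> else if P i j = 1 then cnj \<beta> else \<beta>)"
    if "i < v" "j < v" for i j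
    using that dim P_diag P_off[OF that] by (auto simp: AB)
  have cmod_P: "cmod (complex_of_real (P i j)) = 1" if "i < v" "j < v" "i \<noteq> j" for i j
    using P_off[OF that] by auto
  have index_S: "?S $$ (i, j) =
      (if i < v then if j < v then complex_mat (A - B) $$ (i, j) else ?Q $$ (i, j - v)
       else if j < v then ?R $$ (i - v, j) else complex_mat (B - A) $$ (i - v, j - v))"
    if "i < 2 * v" "j < 2 * v" for i j
    by (subst index_mat_four_block(1)) (use that dim in auto)
  have diag: "?S $$ (i, i) = 0" if "i < 2 * v" for i
    using that P_diag by (simp only: index_S) (auto simp only: entries split: if_splits; simp)
  have off: "cmod (?S $$ (i, j)) = 1" if "i < 2 * v" "j < 2 * v" "i \<noteq> j" for i j
  proof -
    \<comment> \<open>For \<open>i < v\<close> truncated subtraction gives 0, so the bounds hold in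
      every block. Diagonal entries of the blocks \<open>?Q\<close> and \<open>?R\<close> are off
      the diagonal of the whole matrix and equal \<epsilon>, which is unimodular.\<close>
    have "i - v < v" "j - v < v" using that by auto
    moreover have "i - v \<noteq> j - v" if "\<not> i < v" "\<not> j < v" using that \<open>i \<noteq> j\<close> by simp
    ultimately show ?thesis
      unfolding index_S[OF that(1,2)]
      using that(3) cmod_\<epsilon> cmod_\<beta> by (simp add: entries cmod_P del: norm_of_real)
  qed
  show ?thesis
    unfolding S
    by (rule signature_matrix_four_block_spec[OF q0 q1 _ diag[unfolded S] off[unfolded S]])
      (use v in simp_all)
qed

theorem theorem8:
  fixes v :: nat
  shows "((\<exists>G :: 'a pair_pre_digraph. conference_graph v G) \<longrightarrow>
            (\<exists>\<Phi>. equiangular_tight_frame v (2 * v) \<Phi>)) \<and>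
         (\<forall>(G :: 'a pair_pre_digraph) vs (A :: real mat) (B :: real mat)
            (\<epsilon> :: real) (x :: real) (y :: real) (\<beta> :: complex).
            conference_graph v G \<and> distinct vs \<and> set vs = pverts G \<and>
            A = adjacency_matrix G vs \<and> B = all_ones_mat v - 1\<^sub>m v - A \<and>
            \<epsilon> \<in> {1, -1} \<and>
            x = (-1 + sqrt (2 * real v - 1)) / (real v - 1) \<and>
            y = sqrt (1 - x\<^sup>2) \<and>
            \<beta> = complex_of_real (\<epsilon> * x) + \<i> * complex_of_real y \<longrightarrow>
            (\<exists>\<Phi>. signature_matrix v (2 * v) \<Phi>
              (four_block_mat
                (complex_mat (A - B))
                (complex_of_real \<epsilon> \<cdot>\<^sub>m 1\<^sub>m v + \<beta> \<cdot>\<^sub>m complex_mat A + cnj \<beta> \<cdot>\<^sub>m complex_mat B)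
                (complex_of_real \<epsilon> \<cdot>\<^sub>m 1\<^sub>m v + cnj \<beta> \<cdot>\<^sub>m complex_mat A + \<beta> \<cdot>\<^sub>m complex_mat B)
                (complex_mat (B - A)))))"
proof (intro conjI impI allI)
  assume "\<exists>G :: 'a pair_pre_digraph. conference_graph v G"
  then obtain G :: "'a pair_pre_digraph" where G: "conference_graph v G" by blast
  then interpret pair_graph G
    by (auto simp: conference_graph_def strongly_regular_graph_def)
  obtain vs where "distinct vs" "set vs = pverts G"
    using finite_distinct_list[OF pair_finite_verts] by blast
  \<comment> \<open>The existence claim is the case \<epsilon> = 1 for an arbitrary enumeration of
    the vertices.\<close>
  from conference_graph_signature_matrix[OF G this refl refl _ refl refl refl, of 1]
  show "\<exists>\<Phi>. equiangular_tight_frame v (2 * v) \<Phi>"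
    unfolding signature_matrix_def by blast
qed (elim conjE; rule conference_graph_signature_matrix; assumption)

end
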